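(* Let $n\ge3$ be an odd integer. A cardioidal starter of order $n$ exists if and only if $n\in\overline{C_2}$.
   Context: $C_2$ is the set of (odd) primes $p$ such that the multiplicative order of $2$ modulo $p$ is $\equiv2\pmod4$; $\overline{C_2}$ is the set of all products of one or more (not necessarily distinct) primes from $C_2$. A starter of order $n$ ($n$ odd) is a partition of $\mathbb{Z}_n\setminus\{0\}$ into $(n-1)/2$ pairs $\{s_i,t_i\}$ such that the elements $\pm(s_i-t_i)$ are exactly the non-zero elements of $\mathbb{Z}_n$. A starter is cardioidal if every pair has the form $\{i,2i\bmod n\}$ for some $i\in\mathbb{Z}_n\setminus\{0\}$. *)

theory Defs
  imports "HOL-Number_Theory.Number_Theory" "HOL-Library.Disjoint_Sets"
begin

definition C2 :: "nat set" where
  "C2 = {p. prime p \<and> odd p \<and> [ord p 2 = 2] (mod 4)}"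

definition C2_bar :: "nat set" where
  "C2_bar = {\<Prod>\<^sub># M | M. M \<noteq> {#} \<and> set_mset M \<subseteq> C2}"

text \<open>
  The elements of \<open>\<int>\<^sub>n\<close> are represented by their residues \<open>0, \<dots>, n - 1\<close>.
  Equality of sets in the last conjunct of \<open>starter\<close> suffices: the \<open>(n - 1) / 2\<close> pairs yield at
  most \<open>n - 1\<close> differences, so each non-zero residue arises exactly once.
\<close>

definition nonzero_residues :: "nat \<Rightarrow> int set" where
  "nonzero_residues n = {1..<int n}"

definition starter :: "nat \<Rightarrow> int set set \<Rightarrow> bool" where
  "starter n S \<longleftrightarrow>
     odd n \<and>
     partition_on (nonzero_residues n) S \<and>
     card S = (n - 1) div 2 \<and>
     (\<forall>P\<in>S. card P = 2) \<and>
     {d. \<exists>s t. {s, t} \<in> S \<and> (d = (s - t) mod int n \<or> d = - (s - t) mod int n)}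
       = nonzero_residues n"

definition cardioidal :: "nat \<Rightarrow> int set set \<Rightarrow> bool" where
  "cardioidal n S \<longleftrightarrow>
     (\<forall>P\<in>S. \<exists>i\<in>nonzero_residues n. P = {i, 2 * i mod int n})"

end

theory Submission
  imports Defs
begin

text \<open>
  Both sides are equivalent to the existence of an odd \<open>m\<close> with \<open>2\<^sup>m \<equiv> -1 (mod n)\<close>.
  In a cardioidal starter the pair \<open>{i, 2i}\<close> has differences \<open>\<plusminus>i\<close>, so the pairs form a
  perfect matching in the cycles of the doubling map, in which \<open>{i, 2i}\<close> is chosen iff
  \<open>{2i, 4i}\<close> is not (unless \<open>3i = 0\<close>), and in which one of \<open>{i, 2i}\<close> and \<open>{-i, -2i}\<close> is always chosen. On the
  multiples of \<open>n / p\<close>, \<open>p \<noteq> 3\<close>, this forces the order of 2 modulo \<open>p\<close> to be even, say \<open>2h\<close>, with \<open>h\<close> odd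
  because \<open>2\<^sup>h \<equiv> -1\<close>. Conversely, given \<open>m\<close>, each doubling cycle is the union of two distinct
  orbits of multiplication by 4, interchanged by \<open>x \<mapsto> -x\<close>; choosing in every cycle the
  orbit with the smaller minimum yields a starter.
\<close>

section \<open>From starters to orders\<close>

lemma dvd_two_mult_iff:
  fixes x :: int
  assumes "odd n"
  shows "int n dvd 2 * x \<longleftrightarrow> int n dvd x"
  using assms by (simp add: coprime_dvd_mult_right_iff)

lemma dvd_power_two_mult_iff:
  fixes x :: int
  assumes "odd n"
  shows "int n dvd 2 ^ k * x \<longleftrightarrow> int n dvd x"
  using assms by (simp add: coprime_dvd_mult_right_iff)

lemma mod_in_nonzero_residues_iff:
  assumes "n > 0"
  shows "x mod int n \<in> nonzero_residues n \<longleftrightarrow> \<not> int n dvd x"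
proof -
  have "0 \<le> x mod int n" "x mod int n < int n" using assms by simp_all
  then show ?thesis unfolding nonzero_residues_def dvd_eq_mod_eq_0 by auto
qed

lemma nonzero_residues_mod: "x \<in> nonzero_residues n \<Longrightarrow> x mod int n = x"
  unfolding nonzero_residues_def by auto

lemma nonzero_residues_not_dvd: "x \<in> nonzero_residues n \<Longrightarrow> \<not> int n dvd x"
  unfolding nonzero_residues_def by (auto dest: zdvd_imp_le)

text \<open>Both entries are reduced, so \<open>x\<close> may be any integer: arguments such as
  \<open>2 ^ k * x\<close> and \<open>- x\<close> need no reduction first.\<close>

definition doubling_pair :: "nat \<Rightarrow> int \<Rightarrow> int set" where
  "doubling_pair n x = {x mod int n, 2 * x mod int n}"

lemma doubling_pair_cong:
  assumes "[x = y] (mod int n)"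
  shows "doubling_pair n x = doubling_pair n y"
  using assms cong_mult[OF cong_refl assms, of 2]
  by (simp add: doubling_pair_def cong_def)

lemma doubling_pair_of_residue:
  assumes "i \<in> nonzero_residues n"
  shows "doubling_pair n i = {i, 2 * i mod int n}"
  using assms by (simp add: doubling_pair_def nonzero_residues_mod)

text \<open>The block covering the residue of \<open>2 * x\<close> is the pair of some
  \<open>i\<close> with \<open>i\<close> or \<open>2 * i\<close> congruent to \<open>2 * x\<close>,
  so \<open>i\<close> is \<open>2 * x\<close> or \<open>x\<close>. If both pairs were blocks, they
  would share this residue and coincide, whence \<open>x\<close> is congruent to
  \<open>2 * x\<close> or \<open>4 * x\<close>.\<close>

lemma doubling_pair_alternates:
  assumes "starter n S" "cardioidal n S" and x: "\<not> int n dvd 3 * x"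
  shows "doubling_pair n (2 * x) \<in> S \<longleftrightarrow> doubling_pair n x \<notin> S"
proof -
  from assms have n: "odd n" and part: "partition_on (nonzero_residues n) S"
    by (auto simp: starter_def)
  have n0: "n > 0" using n by (auto intro: Nat.gr0I)
  have x2: "\<not> int n dvd 2 * x"
    using x n by (metis dvd_mult dvd_two_mult_iff)
  let ?y = "2 * x mod int n"
  have "?y \<in> nonzero_residues n"
    using x2 n0 mod_in_nonzero_residues_iff by blast
  then obtain P where P: "P \<in> S" "?y \<in> P"
    using part by (auto simp: partition_on_def)
  then obtain i where i: "i \<in> nonzero_residues n" "P = doubling_pair n i"
    using assms(2) doubling_pair_of_residue unfolding cardioidal_def by metis
  have "[i = 2 * x] (mod int n) \<or> [2 * i = 2 * x] (mod int n)"
    using P(2) i by (auto simp: doubling_pair_def cong_def)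
  then have "[i = 2 * x] (mod int n) \<or> [i = x] (mod int n)"
    using n by (metis cong_mult_lcancel coprime_commute coprime_int_iff
        coprime_right_2_iff_odd of_nat_numeral)
  then have ex: "doubling_pair n (2 * x) \<in> S \<or> doubling_pair n x \<in> S"
    using doubling_pair_cong P i by metis
  have False if "doubling_pair n (2 * x) \<in> S" "doubling_pair n x \<in> S"
  proof -
    have "?y \<in> doubling_pair n (2 * x) \<inter> doubling_pair n x"
      by (simp add: doubling_pair_def)
    then have "doubling_pair n (2 * x) = doubling_pair n x"
      using that part unfolding partition_on_def disjoint_def by blast
    then have "x mod int n \<in> {2 * x mod int n, 2 * (2 * x) mod int n}"
      by (auto simp: doubling_pair_def)
    then have "int n dvd 2 * x - x \<or> int n dvd 2 * (2 * x) - x"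
      by (metis insert_iff singletonD mod_eq_dvd_iff)
    then have "int n dvd x \<or> int n dvd 3 * x" by simp
    with x show False by (metis dvd_mult)
  qed
  with ex show ?thesis by blast
qed

lemma doubling_pair_power_alternates:
  assumes "starter n S" "cardioidal n S" and x: "\<not> int n dvd 3 * x"
  shows "doubling_pair n (2 ^ k * x) \<in> S \<longleftrightarrow> (doubling_pair n x \<in> S \<longleftrightarrow> even k)"
proof (induction k)
  case (Suc k)
  have "odd n" using assms by (simp add: starter_def)
  then have "\<not> int n dvd 3 * (2 ^ k * x)"
    using x dvd_power_two_mult_iff[of n k "3 * x"] by (simp add: mult.left_commute)
  from doubling_pair_alternates[OF assms(1,2) this] Suc show ?case
    by (simp add: mult.assoc)
qed simp

text \<open>Some block has \<open>x\<close> as a difference, and the pair of \<open>i\<close> has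
  only the differences \<open>i\<close> and \<open>- i\<close>.\<close>

lemma doubling_pair_or_uminus:
  assumes "starter n S" "cardioidal n S" and x: "\<not> int n dvd x"
  shows "doubling_pair n x \<in> S \<or> doubling_pair n (- x) \<in> S"
proof -
  have n0: "n > 0" using assms(1) by (auto simp: starter_def intro: Nat.gr0I)
  have "x mod int n \<in> nonzero_residues n"
    using x n0 by (simp add: mod_in_nonzero_residues_iff)
  then have "\<exists>s t. {s, t} \<in> S \<and> (x mod int n = (s - t) mod int n \<or> x mod int n = - (s - t) mod int n)"
    using assms(1) unfolding starter_def by blast
  then obtain s t where st: "{s, t} \<in> S"
    "[x = s - t] (mod int n) \<or> [x = - (s - t)] (mod int n)"
    unfolding cong_def by blast
  then obtain i where i: "i \<in> nonzero_residues n" "{s, t} = {i, 2 * i mod int n}"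
    using assms(2) unfolding cardioidal_def by blast
  then have pair: "doubling_pair n i \<in> S"
    using st(1) by (simp add: doubling_pair_of_residue)
  have "[2 * i mod int n = 2 * i] (mod int n)" by simp
  then have 1: "[i - 2 * i mod int n = i - 2 * i] (mod int n)"
    and 2: "[2 * i mod int n - i = 2 * i - i] (mod int n)"
    by (blast intro: cong_diff cong_refl)+
  have "s - t = i - 2 * i mod int n \<or> s - t = 2 * i mod int n - i"
    using i(2) by (auto simp: doubleton_eq_iff)
  then have "[s - t = i] (mod int n) \<or> [s - t = - i] (mod int n)"
    using 1 2 by auto
  then have "[x = i] (mod int n) \<or> [x = - i] (mod int n)"
    using st(2) by (metis cong_trans cong_minus_minus_iff minus_minus)
  then have "[x = i] (mod int n) \<or> [- x = i] (mod int n)"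
    by (metis cong_minus_minus_iff minus_minus)
  then show ?thesis using pair doubling_pair_cong by metis
qed

section \<open>The order of 2 modulo prime divisors\<close>

text \<open>Modulo a prime the only square roots of 1 are 1 and -1, and \<open>2 ^ h\<close> is not
  1 because \<open>h\<close> is below the order.\<close>

lemma half_ord_cong_minus_one:
  assumes "prime p" and h: "ord p 2 = 2 * h" and "h > 0"
  shows "[2 ^ h = - 1] (mod int p)"
proof -
  have "[2 ^ (2 * h) = 1] (mod p)" using h ord[of 2 p] by metis
  then have "[int (2 ^ (2 * h)) = int 1] (mod int p)" by (simp only: cong_int_iff)
  then have "int p dvd (2 ^ h) ^ 2 - 1"
    by (simp add: cong_iff_dvd_diff power_mult mult.commute)
  then have "int p dvd (2 ^ h - 1) * (2 ^ h + 1)"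
    by (simp add: algebra_simps power2_eq_square)
  moreover have "\<not> int p dvd 2 ^ h - 1"
  proof
    assume "int p dvd 2 ^ h - 1"
    then have "[int (2 ^ h) = int 1] (mod int p)" by (simp add: cong_iff_dvd_diff)
    then have "[2 ^ h = 1] (mod p)" by (simp only: cong_int_iff)
    then have "ord p 2 dvd h" by (simp only: ord_divides)
    with h \<open>h > 0\<close> show False by (auto dest: dvd_imp_le)
  qed
  ultimately have "int p dvd 2 ^ h + 1"
    using \<open>prime p\<close> by (simp add: prime_dvd_mult_iff)
  then show ?thesis by (simp add: cong_iff_dvd_diff)
qed

lemma starter_prime_factor_in_C2:
  assumes "starter n S" "cardioidal n S" "prime p" "p dvd n"
  shows "p \<in> C2"
proof (cases "p = 3")
  case True
  \<comment> \<open>Alternation says nothing about the multiples of \<open>n / 3\<close>, which 3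
    annihilates, so the order is computed directly.\<close>
  have "ord 3 (2::nat) = 2"
    by (simp add: ord_eq_2_iff cong_def)
  with True show ?thesis by (simp add: C2_def)
next
  case False
  have n: "odd n" using assms(1) by (simp add: starter_def)
  then have p: "odd p" using \<open>p dvd n\<close> by (meson dvd_trans)
  have n0: "n > 0" using n by (auto intro: Nat.gr0I)
  obtain x where x: "n = p * x" using \<open>p dvd n\<close> by blast
  have x0: "x > 0" using x n0 by auto
  \<comment> \<open>With \<open>x = n / p\<close>, the multiples of \<open>x\<close> form a copy of
    the residues modulo \<open>p\<close> inside those modulo \<open>n\<close>.\<close>
  have cong_lift: "[a * int x = b * int x] (mod int n)" if "[a = b] (mod int p)" for a b
    using that unfolding x by (simp add: cong_iff_dvd_diff flip: left_diff_distrib)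
  have dvd3: "\<not> int n dvd 3 * int x"
  proof
    assume "int n dvd 3 * int x"
    then have "int p dvd 3" using x0 by (simp add: x)
    then have "p dvd 3" by (metis int_dvd_int_iff of_nat_numeral)
    then show False
      using False \<open>prime p\<close> by (simp add: primes_dvd_imp_eq)
  qed
  have dvd1: "\<not> int n dvd int x" and dvd2: "\<not> int n dvd 2 * int x"
    using dvd3 n by (metis dvd_mult dvd_two_mult_iff)+
  note alt = doubling_pair_power_alternates[OF assms(1,2) dvd3]
  have "[2 ^ ord p 2 = 1] (mod p)" by (rule ord)
  then have "[int (2 ^ ord p 2) = int 1] (mod int p)" by (simp only: cong_int_iff)
  then have "[2 ^ ord p 2 * int x = 1 * int x] (mod int n)"
    by (intro cong_lift) simp
  then have "doubling_pair n (2 ^ ord p 2 * int x) = doubling_pair n (int x)"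
    using doubling_pair_cong by fastforce
  \<comment> \<open>An odd number of doublings would flip the membership of the pair of
    \<open>x\<close>, yet this many doublings return to that pair.\<close>
  then have "even (ord p 2)" using alt[of "ord p 2"] by auto
  then obtain h where h: "ord p 2 = 2 * h" by blast
  have "ord p 2 > 0" using p by (simp add: ord_gt_0_iff)
  then have "h > 0" using h by simp
  have minus: "[2 ^ h = - 1] (mod int p)"
    using half_ord_cong_minus_one \<open>prime p\<close> h \<open>h > 0\<close> by blast
  have "odd h"
  proof
    assume "even h"
    have A: "doubling_pair n (2 ^ h * int x) = doubling_pair n (- int x)"
      using cong_lift[OF minus] doubling_pair_cong by fastforce
    have "[2 * 2 ^ h * int x = 2 * (- 1) * int x] (mod int n)"
      by (intro cong_lift cong_mult cong_refl minus)
    then have B: "doubling_pair n (2 ^ Suc h * int x) = doubling_pair n (- (2 * int x))"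
      using doubling_pair_cong by fastforce
    \<comment> \<open>For even \<open>h\<close> the pairs of \<open>x\<close> and \<open>- x\<close>
      are both in \<open>S\<close> or both outside, so both are inside. The same holds for
      \<open>2 * x\<close>, against alternation.\<close>
    have "doubling_pair n (int x) \<in> S"
      using doubling_pair_or_uminus[OF assms(1,2) dvd1] A alt[of h] \<open>even h\<close> by auto
    moreover have "doubling_pair n (2 * int x) \<in> S"
      using doubling_pair_or_uminus[OF assms(1,2) dvd2] B alt[of "Suc h"] alt[of 1] \<open>even h\<close>
      by auto
    ultimately show False using alt[of 1] by simp
  qed
  then have "[ord p 2 = 2] (mod 4)" unfolding cong_def h by presburger
  then show ?thesis using \<open>prime p\<close> p by (simp add: C2_def)
qed

section \<open>From orders to starters\<close>

text \<open>With \<open>X = 2 ^ (a * b)\<close>, both \<open>u\<close> and \<open>v\<close> divide \<open>X + 1\<close>, and \<open>u\<close> divides the cofactor in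
  \<open>X ^ u + 1 = (X + 1) * (\<Sum>i<u. (- X) ^ i)\<close>, as its summands are 1 modulo \<open>u\<close>.\<close>

lemma power_two_cong_minus_one_mult:
  fixes u v :: nat
  assumes "[2 ^ a = - 1] (mod int u)" "[2 ^ b = - 1] (mod int v)" and "odd a" "odd b" "odd u"
  shows "[2 ^ (a * b * u) = - 1] (mod int (u * v))"
proof -
  define X :: int where "X = 2 ^ (a * b)"
  have u: "[X = - 1] (mod int u)"
    using cong_pow[OF assms(1), of b] \<open>odd b\<close> by (simp add: X_def power_mult)
  have v: "[X = - 1] (mod int v)"
    using cong_pow[OF assms(2), of a] \<open>odd a\<close> by (simp add: X_def mult.commute[of a] power_mult)
  have "[- X = 1] (mod int u)"
    using u by (metis cong_minus_minus_iff minus_minus)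
  then have "[(\<Sum>i<u. (- X) ^ i) = (\<Sum>i<u. 1)] (mod int u)"
    by (intro cong_sum) (metis cong_pow power_one)
  then have "int u dvd (\<Sum>i<u. (- X) ^ i)"
    by (simp add: cong_dvd_iff)
  moreover have "int v dvd X + 1" using v by (simp add: cong_iff_dvd_diff)
  ultimately have "int u * int v dvd (\<Sum>i<u. (- X) ^ i) * (X + 1)" by (rule mult_dvd_mono)
  also have "(\<Sum>i<u. (- X) ^ i) * (X + 1) = 1 - (- X) ^ u"
    by (simp add: one_diff_power_eq mult.commute)
  also have "\<dots> = X ^ u - - 1" using \<open>odd u\<close> by simp
  finally show ?thesis by (simp add: X_def power_mult cong_iff_dvd_diff)
qed

lemma C2_cong_minus_one:
  assumes "p \<in> C2"
  obtains h where "odd h" "[2 ^ h = - 1] (mod int p)"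
proof -
  have "ord p 2 mod 4 = 2" using assms by (simp add: C2_def cong_def)
  define h where "h = ord p 2 div 2"
  have "ord p 2 = 2 * h" "odd h" using \<open>ord p 2 mod 4 = 2\<close> unfolding h_def by presburger+
  with that assms show ?thesis
    using half_ord_cong_minus_one by (auto simp: C2_def odd_pos)
qed

lemma C2_prod_cong_minus_one:
  assumes "set_mset M \<subseteq> C2"
  shows "odd (\<Prod>\<^sub># M) \<and> (\<exists>m. odd m \<and> [2 ^ m = - 1] (mod int (\<Prod>\<^sub># M)))"
  using assms
proof (induction M)
  case empty
  \<comment> \<open>The empty product is 1, modulo which every congruence holds.\<close>
  show ?case by (auto intro: exI[of _ 1])
next
  case (add p M)
  then obtain m where m: "odd m" "[2 ^ m = - 1] (mod int (\<Prod>\<^sub># M))" and oddM: "odd (\<Prod>\<^sub># M)"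
    by auto
  have p: "p \<in> C2" "odd p" using add.prems by (auto simp: C2_def)
  obtain h where h: "odd h" "[2 ^ h = - 1] (mod int p)"
    using C2_cong_minus_one p(1) by blast
  have "[2 ^ (h * m * p) = - 1] (mod int (p * \<Prod>\<^sub># M))"
    by (rule power_two_cong_minus_one_mult) (use h m p in auto)
  then have "[2 ^ (h * m * p) = - 1] (mod int (\<Prod>\<^sub># (add_mset p M)))" by simp
  moreover have "odd (h * m * p)" using h m p by simp
  moreover have "odd (\<Prod>\<^sub># (add_mset p M))" using p oddM by simp
  ultimately show ?case by blast
qed

section \<open>Orbits of multiplication by 4\<close>

definition orbit4 :: "nat \<Rightarrow> int \<Rightarrow> int set" where
  "orbit4 n x = range (\<lambda>k. 4 ^ k * x mod int n)"

text \<open>A canonical label of the orbit, used to choose between two orbits.\<close>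

definition orbit4_min :: "nat \<Rightarrow> int \<Rightarrow> int" where
  "orbit4_min n x = Min (orbit4 n x)"

lemma four_power: "(4::int) ^ k = 2 ^ (2 * k)"
  by (simp add: power_mult)

lemma orbit4_cong:
  assumes "[x = y] (mod int n)"
  shows "orbit4 n x = orbit4 n y"
proof -
  have "4 ^ k * x mod int n = 4 ^ k * y mod int n" for k
    using cong_mult[OF cong_refl assms] by (simp add: cong_def)
  then show ?thesis by (simp add: orbit4_def)
qed

lemma finite_orbit4: "n > 0 \<Longrightarrow> finite (orbit4 n x)"
  by (rule finite_subset[of _ "{0..<int n}"]) (auto simp: orbit4_def)

lemma orbit4_mult_power4_subset: "orbit4 n (4 ^ k * x) \<subseteq> orbit4 n x"
  unfolding orbit4_def by (auto simp: power_add[symmetric] mult.assoc[symmetric])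

locale power_two_minus_one =
  fixes n m :: nat
  assumes odd_n: "odd n" and odd_m: "odd m" and minus_one: "[2 ^ m = - 1] (mod int n)"
begin

lemma n_pos: "n > 0"
  using odd_n by (auto intro: Nat.gr0I)

lemma four_power_m: "[4 ^ m = 1] (mod int n)"
proof -
  have "[(2 ^ m) ^ 2 = (- 1) ^ 2] (mod int n)" by (intro cong_pow minus_one)
  then show ?thesis by (simp add: four_power mult.commute[of 2 m] power_mult)
qed

text \<open>Since \<open>4 ^ m\<close> is 1, multiplication by \<open>4 ^ (k * (m - 1))\<close>
  undoes multiplication by \<open>4 ^ k\<close>.\<close>

lemma orbit4_mult_power4: "orbit4 n (4 ^ k * x) = orbit4 n x"
proof
  have "m > 0" using odd_m by (rule odd_pos)
  then have split: "k * m = k * (m - 1) + k" by (cases m) auto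
  have "[(4 ^ m) ^ k * x = 1 ^ k * x] (mod int n)"
    by (intro cong_mult cong_pow cong_refl four_power_m)
  then have "[4 ^ (k * (m - 1)) * (4 ^ k * x) = x] (mod int n)"
    by (simp flip: power_mult power_add add: mult.assoc[symmetric] split mult.commute[of m])
  then show "orbit4 n x \<subseteq> orbit4 n (4 ^ k * x)"
    using orbit4_cong orbit4_mult_power4_subset by metis
qed (rule orbit4_mult_power4_subset)

text \<open>For \<open>m = 2 * k + 1\<close>, \<open>- x\<close> is congruent to
  \<open>2 ^ m * x = 4 ^ k * (2 * x)\<close>.\<close>

lemma orbit4_uminus: "orbit4 n (- x) = orbit4 n (2 * x)"
proof -
  obtain k where k: "m = 2 * k + 1" using odd_m by (auto elim: oddE)
  have "[2 ^ m * x = - 1 * x] (mod int n)" by (intro cong_mult minus_one cong_refl)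
  then have "[4 ^ k * (2 * x) = - x] (mod int n)" by (simp add: k four_power mult_ac)
  then show ?thesis using orbit4_cong orbit4_mult_power4 by metis
qed

text \<open>A relation \<open>4 ^ i * x = 2 * 4 ^ j * x\<close> would say \<open>y = 2 ^ t * y\<close> with \<open>t\<close> odd for a
  multiple \<open>y\<close> of \<open>x\<close>, so \<open>y = 2 ^ (t * m) * y = - y\<close>.\<close>

lemma orbit4_disjoint:
  assumes x: "\<not> int n dvd x"
  shows "orbit4 n x \<inter> orbit4 n (2 * x) = {}"
proof (rule ccontr)
  assume "\<not> ?thesis"
  then obtain i j where "[4 ^ i * x = 4 ^ j * (2 * x)] (mod int n)"
    unfolding orbit4_def cong_def by auto
  then have ij: "[2 ^ (2 * i) * x = 2 ^ (2 * j + 1) * x] (mod int n)"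
    by (simp add: four_power mult_ac)
  \<comment> \<open>Either exponent may be the smaller one; their opposite parities make the
    difference \<open>t\<close> odd.\<close>
  have shift: "\<exists>t. odd t \<and> [2 ^ a * x = 2 ^ t * (2 ^ a * x)] (mod int n)"
    if "[2 ^ a * x = 2 ^ b * x] (mod int n)" "a < b" "odd (a + b)" for a b
  proof (intro exI conjI)
    show "odd (b - a)" using that by auto
    show "[2 ^ a * x = 2 ^ (b - a) * (2 ^ a * x)] (mod int n)"
      using that by (simp flip: power_add mult.assoc)
  qed
  have "\<exists>a t. odd t \<and> [2 ^ a * x = 2 ^ t * (2 ^ a * x)] (mod int n)"
  proof (cases "2 * i < 2 * j + 1")
    case True
    with shift[OF ij] show ?thesis by auto
  next
    case False
    then have "2 * j + 1 < 2 * i" by presburger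
    with shift[OF cong_sym[OF ij]] show ?thesis by (metis even_add even_mult_iff odd_one even_numeral)
  qed
  then obtain a t where t: "odd t" "[2 ^ a * x = 2 ^ t * (2 ^ a * x)] (mod int n)" by blast
  define y where "y = 2 ^ a * x"
  have y: "[2 ^ t * y = y] (mod int n)" using t by (simp add: y_def cong_sym)
  have "[(2 ^ t) ^ k * y = y] (mod int n)" for k
  proof (induction k)
    case (Suc k)
    have "[2 ^ t * ((2 ^ t) ^ k * y) = 2 ^ t * y] (mod int n)"
      by (intro cong_mult cong_refl Suc)
    with y show ?case by (simp add: mult.assoc) (metis cong_trans)
  qed simp
  then have "[(2 ^ t) ^ m * y = y] (mod int n)" .
  moreover have "[(2 ^ m) ^ t * y = (- 1) ^ t * y] (mod int n)"
    by (intro cong_mult cong_pow minus_one cong_refl)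
  ultimately have "[y = - y] (mod int n)"
    using t(1) by (simp flip: power_mult add: mult.commute[of t m]) (metis cong_sym cong_trans)
  then have "int n dvd 2 * y" by (simp add: cong_iff_dvd_diff)
  then have "int n dvd x"
    using odd_n dvd_two_mult_iff dvd_power_two_mult_iff unfolding y_def by metis
  with x show False ..
qed

text \<open>One of the two 4-orbits of each doubling cycle; its elements will be the
  \<open>i\<close> of the chosen pairs.\<close>

definition low_half :: "int set" where
  "low_half = {x \<in> nonzero_residues n. orbit4_min n x < orbit4_min n (2 * x)}"

lemma mod_in_low_half_iff:
  assumes "\<not> int n dvd x"
  shows "x mod int n \<in> low_half \<longleftrightarrow> orbit4_min n x < orbit4_min n (2 * x)"
proof -
  have "[x mod int n = x] (mod int n)" by simp
  moreover from this have "[2 * (x mod int n) = 2 * x] (mod int n)"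
    by (rule cong_mult[OF cong_refl])
  ultimately show ?thesis
    using assms unfolding low_half_def orbit4_min_def
    by (simp only: orbit4_cong mem_Collect_eq mod_in_nonzero_residues_iff[OF n_pos] simp_thms)
qed

lemma orbit4_min_neq:
  assumes "\<not> int n dvd x"
  shows "orbit4_min n x \<noteq> orbit4_min n (2 * x)"
proof -
  have "orbit4_min n y \<in> orbit4 n y" for y
    unfolding orbit4_min_def using finite_orbit4[OF n_pos] by (intro Min_in) (auto simp: orbit4_def)
  with orbit4_disjoint[OF assms] show ?thesis by (metis disjoint_iff)
qed

text \<open>Doubling interchanges the two orbits, because \<open>4 * x\<close> is back in the orbit
  of \<open>x\<close>, and their minima differ.\<close>

lemma double_in_low_half_iff:
  assumes "\<not> int n dvd x"
  shows "2 * x mod int n \<in> low_half \<longleftrightarrow> x mod int n \<notin> low_half"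
proof -
  have "orbit4_min n (2 * (2 * x)) = orbit4_min n x"
    using orbit4_mult_power4[of 1 x] by (simp add: orbit4_min_def)
  moreover have "\<not> int n dvd 2 * x" using assms odd_n by (simp only: dvd_two_mult_iff not_False_eq_True)
  ultimately show ?thesis
    using mod_in_low_half_iff[OF assms] mod_in_low_half_iff[of "2 * x"] orbit4_min_neq[OF assms] by auto
qed

text \<open>Negation interchanges the same two orbits as doubling, by
  \<open>orbit4_uminus\<close>.\<close>

lemma uminus_in_low_half_iff:
  assumes "\<not> int n dvd x"
  shows "- x mod int n \<in> low_half \<longleftrightarrow> x mod int n \<notin> low_half"
proof -
  have "orbit4_min n (2 * - x) = orbit4_min n x"
    using orbit4_uminus[of "- x"] by (simp add: orbit4_min_def)
  moreover have "orbit4_min n (- x) = orbit4_min n (2 * x)"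
    by (simp add: orbit4_min_def orbit4_uminus)
  ultimately show ?thesis
    using mod_in_low_half_iff[OF assms] mod_in_low_half_iff[of "- x"] orbit4_min_neq[OF assms] assms by auto
qed

section \<open>The starter built from the chosen orbits\<close>

definition orbit_starter :: "int set set" where
  "orbit_starter = (\<lambda>i. {i, 2 * i mod int n}) ` low_half"

lemma low_half_residue: "i \<in> low_half \<Longrightarrow> i \<in> nonzero_residues n"
  by (simp add: low_half_def)

lemma double_notin_low_half:
  assumes "i \<in> low_half"
  shows "2 * i mod int n \<notin> low_half"
  using double_in_low_half_iff[OF nonzero_residues_not_dvd] low_half_residue[OF assms] assms
  by (simp add: nonzero_residues_mod)

lemma double_residue:
  assumes "i \<in> nonzero_residues n"
  shows "2 * i mod int n \<in> nonzero_residues n"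
  using nonzero_residues_not_dvd[OF assms] odd_n
  by (simp only: mod_in_nonzero_residues_iff[OF n_pos] dvd_two_mult_iff not_False_eq_True)

lemma double_inj:
  assumes "i \<in> nonzero_residues n" "j \<in> nonzero_residues n" "2 * i mod int n = 2 * j mod int n"
  shows "i = j"
proof -
  have "int n dvd 2 * (i - j)"
    using assms(3) by (simp add: mod_eq_dvd_iff right_diff_distrib)
  then have "i mod int n = j mod int n"
    using dvd_two_mult_iff[OF odd_n] by (simp only: mod_eq_dvd_iff)
  with assms show ?thesis by (simp add: nonzero_residues_mod)
qed

lemma orbit_starter_card_2: "P \<in> orbit_starter \<Longrightarrow> card P = 2"
  using double_notin_low_half by (fastforce simp: orbit_starter_def card_2_iff)

text \<open>Doubling is injective and leads out of \<open>low_half\<close>, so a common element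
  \<open>z\<close> is the first entry of both pairs or the double in both.\<close>

lemma low_half_pairs_eq:
  assumes "i \<in> low_half" "j \<in> low_half" "z \<in> {i, 2 * i mod int n}" "z \<in> {j, 2 * j mod int n}"
  shows "i = j"
  using assms double_notin_low_half double_inj low_half_residue by blast

lemma Union_orbit_starter: "\<Union> orbit_starter = nonzero_residues n"
proof
  show "\<Union> orbit_starter \<subseteq> nonzero_residues n"
    using low_half_residue double_residue by (auto simp: orbit_starter_def)
  show "nonzero_residues n \<subseteq> \<Union> orbit_starter"
  proof
    fix x assume x: "x \<in> nonzero_residues n"
    show "x \<in> \<Union> orbit_starter"
    proof (cases "x \<in> low_half")
      case False
      \<comment> \<open>A residue outside \<open>low_half\<close> is covered as a double: its half
        \<open>y\<close>, obtained by inverting 2, lies in \<open>low_half\<close>.\<close>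
      obtain y where y: "[2 * y = x] (mod int n)"
        using cong_solve_coprime_int[of 2 "int n"] odd_n
        by (metis cong_scalar_right coprime_commute coprime_int_iff coprime_right_2_iff_odd
            mult.assoc mult_1 of_nat_numeral)
      then have yx: "2 * y mod int n = x" using x by (simp add: cong_def nonzero_residues_mod)
      have "\<not> int n dvd 2 * y"
        using x yx mod_in_nonzero_residues_iff[OF n_pos] by metis
      then have "\<not> int n dvd y" by (metis dvd_mult)
      with False yx have "y mod int n \<in> low_half" using double_in_low_half_iff by metis
      moreover have "x = 2 * (y mod int n) mod int n" using yx by (simp add: mod_mult_right_eq)
      ultimately show ?thesis by (auto simp: orbit_starter_def)
    qed (auto simp: orbit_starter_def)
  qed
qed

lemma partition_orbit_starter: "partition_on (nonzero_residues n) orbit_starter"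
  unfolding partition_on_def
proof (intro conjI Union_orbit_starter)
  show "disjoint orbit_starter"
  proof (intro disjointI)
    fix P Q assume "P \<in> orbit_starter" "Q \<in> orbit_starter" "P \<noteq> Q"
    then obtain i j where "i \<in> low_half" "j \<in> low_half" "i \<noteq> j"
      "P = {i, 2 * i mod int n}" "Q = {j, 2 * j mod int n}"
      by (auto simp: orbit_starter_def)
    then show "P \<inter> Q = {}" using low_half_pairs_eq[of i j] by auto
  qed
  show "{} \<notin> orbit_starter" by (auto simp: orbit_starter_def)
qed

lemma card_orbit_starter: "card orbit_starter = (n - 1) div 2"
proof -
  have "card (\<Union> orbit_starter) = sum card orbit_starter"
    using partition_orbit_starter orbit_starter_card_2
    by (intro card_Union_disjoint) (auto simp: partition_on_def disjoint_def pairwise_def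
        disjnt_def card_2_iff)
  also have "\<dots> = 2 * card orbit_starter" using orbit_starter_card_2 by simp
  finally show ?thesis by (simp add: Union_orbit_starter nonzero_residues_def nat_diff_distrib)
qed

text \<open>The pair of \<open>i\<close> yields \<open>i\<close> and \<open>- i\<close>, and
  \<open>low_half\<close> contains exactly one of each residue and its negative.\<close>

lemma differences_orbit_starter:
  "{d. \<exists>s t. {s, t} \<in> orbit_starter \<and> (d = (s - t) mod int n \<or> d = - (s - t) mod int n)}
     = nonzero_residues n" (is "?D = _")
proof
  have diff: "(i - 2 * i mod int n) mod int n = - i mod int n"
             "(2 * i mod int n - i) mod int n = i mod int n" for i
    by (simp_all add: mod_diff_right_eq mod_diff_left_eq)
  show "?D \<subseteq> nonzero_residues n"
  proof
    fix d assume "d \<in> ?D"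
    then obtain s t where st: "{s, t} \<in> orbit_starter" "d = (s - t) mod int n \<or> d = (t - s) mod int n"
      by auto
    then obtain i where i: "i \<in> low_half" "{s, t} = {i, 2 * i mod int n}" by (auto simp: orbit_starter_def)
    then have "d = i mod int n \<or> d = - i mod int n"
      using st(2) diff[of i] by (auto simp: doubleton_eq_iff)
    moreover have "\<not> int n dvd i" using i(1) low_half_residue nonzero_residues_not_dvd by blast
    ultimately show "d \<in> nonzero_residues n"
      using mod_in_nonzero_residues_iff[OF n_pos] by (metis dvd_minus_iff)
  qed
  show "nonzero_residues n \<subseteq> ?D"
  proof
    fix d assume d: "d \<in> nonzero_residues n"
    then have "d mod int n \<in> low_half \<or> - d mod int n \<in> low_half"
      using uminus_in_low_half_iff nonzero_residues_not_dvd by blast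
    then obtain i where i: "i \<in> low_half" "i = d mod int n \<or> i = - d mod int n" by blast
    then have "d mod int n = i mod int n \<or> d mod int n = - i mod int n"
      by (auto simp: mod_minus_eq)
    then have "d = (i - 2 * i mod int n) mod int n \<or> d = - (i - 2 * i mod int n) mod int n"
      using diff[of i] nonzero_residues_mod[OF d] by auto
    moreover have "{i, 2 * i mod int n} \<in> orbit_starter" using i(1) by (auto simp: orbit_starter_def)
    ultimately show "d \<in> ?D" by blast
  qed
qed

lemma starter_orbit_starter: "starter n orbit_starter"
  unfolding starter_def
  using odd_n partition_orbit_starter card_orbit_starter orbit_starter_card_2 differences_orbit_starter by blast

lemma cardioidal_orbit_starter: "cardioidal n orbit_starter"
  unfolding cardioidal_def orbit_starter_def using low_half_residue by blast

end

theorem theorem5: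
  fixes n :: nat
  assumes "n \<ge> 3" and "odd n"
  shows "(\<exists>S. starter n S \<and> cardioidal n S) \<longleftrightarrow> n \<in> C2_bar"
proof
  assume "\<exists>S. starter n S \<and> cardioidal n S"
  then obtain S where "starter n S" "cardioidal n S" by blast
  then have "set_mset (prime_factorization n) \<subseteq> C2"
    using starter_prime_factor_in_C2 by (auto simp: in_prime_factors_iff)
  moreover have "\<Prod>\<^sub># (prime_factorization n) = n"
    using assms(1) by (simp add: prod_mset_prime_factorization_nat)
  moreover from this have "prime_factorization n \<noteq> {#}"
    using assms(1) by (metis prod_mset_empty numeral_le_one_iff semiring_norm(70))
  ultimately show "n \<in> C2_bar" unfolding C2_bar_def by (metis (mono_tags, lifting) mem_Collect_eq)
next
  assume "n \<in> C2_bar"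
  then obtain M where "n = \<Prod>\<^sub># M" "set_mset M \<subseteq> C2" by (auto simp: C2_bar_def)
  then obtain m where "odd m" "[2 ^ m = - 1] (mod int n)"
    using C2_prod_cong_minus_one by blast
  then interpret power_two_minus_one n m
    using assms(2) by unfold_locales
  show "\<exists>S. starter n S \<and> cardioidal n S" using starter_orbit_starter cardioidal_orbit_starter by blast
qed

end
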